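(* Let $X$ be a complete separable metric space and let $\pi$ be a Radon kernel from $\mathcal M^{\cdot\cdot}(X)$ to $X$ which is vaguely continuous and satisfies the cocycle condition: for every $\mu\in\mathcal M^{\cdot\cdot}(X)$, $\pi(\mu+\delta_y,\mathrm dx)\,\pi(\mu,\mathrm dy)=\pi(\mu+\delta_x,\mathrm dy)\,\pi(\mu,\mathrm dx)$ as measures on $X\times X$. Consider the conditions $(\mathcal A_2)$: for every $y\in X$ and every $\mu\in\mathcal M^{\cdot\cdot}(X)$, $\pi(\mu+\delta_y,B)=\pi(\mu,B)$ for all Borel sets $B\subseteq X\setminus\{y\}$; $(\mathcal J)$: for every $x\in X$, the map $\mu\mapsto\pi(\mu,\{x\})$ is $\sigma(\zeta_{\{x\}})$-measurable, where $\zeta_{\{x\}}(\mu)=\mu(\{x\})$. Then: 1. $(\mathcal A_2)$ implies $(\mathcal J)$; 2. if $X$ is in addition discrete, then $(\mathcal J)$ implies $(\mathcal A_2)$.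
   Context: Let $X$ be a complete separable metric space with Borel $\sigma$-field $\mathcal B(X)$, and let $\mathcal B_0(X)$ be the ring of (metrically) bounded Borel sets. $\mathcal M(X)$ is the set of Radon measures, meaning Borel measures that are finite on every $B\in\mathcal B_0(X)$. It carries the vague topology: $\mu_k\to\mu$ iff $\int f\,\mathrm d\mu_k\to\int f\,\mathrm d\mu$ for every bounded continuous $f:X\to\mathbb R$ with bounded support. $\mathcal M^{\cdot\cdot}(X)\subset\mathcal M(X)$ is the measurable subset of point measures, i.e. those $\mu\in\mathcal M(X)$ with $\mu(B)\in\mathbb N\cup\{+\infty\}$ for all $B\in\mathcal B(X)$ (with $0\in\mathbb N$). $\delta_x$ is the Dirac measure at $x$. A Radon kernel from $\mathcal M^{\cdot\cdot}(X)$ to $X$ is a map $\pi$ assigning to $\mu\in\mathcal M^{\cdot\cdot}(X)$ and $B\in\mathcal B(X)$ a nonnegative value $\pi(\mu,B)$ such that $\pi(\mu,\cdot)\in\mathcal M(X)$ for each $\mu$, and $\mu\mapsto\pi(\mu,B)$ is measurable for each $B\in\mathcal B(X)$. It is vaguely continuous if $\mu\mapsto\pi(\mu,\cdot)$ is continuous from $\mathcal M^{\cdot\cdot}(X)$ to $\mathcal M(X)$, both with the vague topology. *)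

theory Defs
  imports "HOL-Probability.Giry_Monad"
begin

definition radon_measures :: "'a::metric_space measure set" where
  "radon_measures =
     {\<mu>. sets \<mu> = sets borel \<and> (\<forall>B\<in>sets borel. bounded B \<longrightarrow> emeasure \<mu> B < \<infinity>)}"

definition point_measures :: "'a::metric_space measure set" where
  "point_measures = {\<mu> \<in> radon_measures. \<forall>B\<in>sets borel. emeasure \<mu> B \<in> \<nat> \<union> {\<infinity>}}"

definition vague_test_functions :: "('a::metric_space \<Rightarrow> real) set" where
  "vague_test_functions =
     {f. continuous_on UNIV f \<and> bounded (range f) \<and> bounded (closure {x. f x \<noteq> 0})}"

text \<open>
  The coarsest topology on the set of Radon measures for which all the maps
  \<open>\<mu> \<mapsto> \<integral> f d\<mu>\<close>, \<open>f\<close> a test function, are continuous.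
\<close>
definition vague_topology :: "'a::metric_space measure topology" where
  "vague_topology = topology_generated_by
     {{\<mu> \<in> radon_measures. (\<integral>x. f x \<partial>\<mu>) \<in> U} | f U. f \<in> vague_test_functions \<and> open U}"

text \<open>
  The measurable structure on the set of Radon measures is the Borel \<open>\<sigma>\<close>-field of the vague
  topology. On a complete separable metric space this is also the \<open>\<sigma>\<close>-field generated by the
  evaluations \<open>\<mu> \<mapsto> \<mu> B\<close>, \<open>B\<close> a (bounded) Borel set.
\<close>
definition radon_space :: "'a::metric_space measure measure" where
  "radon_space = sigma radon_measures {U. openin vague_topology U}"

definition point_space :: "'a::metric_space measure measure" where
  "point_space = restrict_space radon_space point_measures"

text \<open>There is no addition on \<^typ>\<open>'a measure\<close> in the library.\<close>
definition add_measure :: "'a measure \<Rightarrow> 'a measure \<Rightarrow> 'a measure" where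
  "add_measure \<mu> \<nu> = measure_of (space \<mu>) (sets \<mu>) (\<lambda>B. emeasure \<mu> B + emeasure \<nu> B)"

abbreviation dirac :: "'a::topological_space \<Rightarrow> 'a measure" where
  "dirac x \<equiv> return borel x"

text \<open>
  A kernel from the point measures is represented by \<open>\<pi>\<close> with \<open>\<pi>(\<mu>, B) = emeasure (\<pi> \<mu>) B\<close>; the values
  of \<open>\<pi>\<close> outside \<^const>\<open>point_measures\<close> are irrelevant.
\<close>
definition radon_kernel :: "('a::metric_space measure \<Rightarrow> 'a measure) \<Rightarrow> bool" where
  "radon_kernel \<pi> \<longleftrightarrow>
     (\<forall>\<mu>\<in>point_measures. \<pi> \<mu> \<in> radon_measures) \<and>
     (\<forall>B\<in>sets borel. (\<lambda>\<mu>. emeasure (\<pi> \<mu>) B) \<in> borel_measurable point_space)"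

definition vaguely_continuous :: "('a::metric_space measure \<Rightarrow> 'a measure) \<Rightarrow> bool" where
  "vaguely_continuous \<pi> \<longleftrightarrow>
     continuous_map (subtopology vague_topology point_measures) vague_topology \<pi>"

text \<open>
  The two sides are the values at \<open>C\<close> of the measures \<open>\<pi>(\<mu> + \<delta>\<^sub>y, dx) \<pi>(\<mu>, dy)\<close> and
  \<open>\<pi>(\<mu> + \<delta>\<^sub>x, dy) \<pi>(\<mu>, dx)\<close> in the variables \<open>(x, y)\<close>.
\<close>
definition cocycle_condition :: "('a::metric_space measure \<Rightarrow> 'a measure) \<Rightarrow> bool" where
  "cocycle_condition \<pi> \<longleftrightarrow>
     (\<forall>\<mu>\<in>point_measures. \<forall>C\<in>sets (borel \<Otimes>\<^sub>M borel).
        (\<integral>\<^sup>+y. (\<integral>\<^sup>+x. indicator C (x, y) \<partial>\<pi> (add_measure \<mu> (dirac y))) \<partial>\<pi> \<mu>) =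
        (\<integral>\<^sup>+x. (\<integral>\<^sup>+y. indicator C (x, y) \<partial>\<pi> (add_measure \<mu> (dirac x))) \<partial>\<pi> \<mu>))"

definition condition_A2 :: "('a::metric_space measure \<Rightarrow> 'a measure) \<Rightarrow> bool" where
  "condition_A2 \<pi> \<longleftrightarrow>
     (\<forall>y. \<forall>\<mu>\<in>point_measures. \<forall>B\<in>sets borel. B \<subseteq> UNIV - {y} \<longrightarrow>
        emeasure (\<pi> (add_measure \<mu> (dirac y))) B = emeasure (\<pi> \<mu>) B)"

text \<open>
  \<^term>\<open>vimage_algebra point_measures (\<lambda>\<mu>. emeasure \<mu> {x}) borel\<close> is \<open>\<sigma>(\<zeta>\<^bsub>{x}\<^esub>)\<close> on the set of
  point measures.
\<close>
definition condition_J :: "('a::metric_space measure \<Rightarrow> 'a measure) \<Rightarrow> bool" where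
  "condition_J \<pi> \<longleftrightarrow>
     (\<forall>x. (\<lambda>\<mu>. emeasure (\<pi> \<mu>) {x}) \<in>
        borel_measurable (vimage_algebra point_measures (\<lambda>\<mu>. emeasure \<mu> {x}) borel))"

lemma sets_add_measure [simp]: "sets (add_measure \<mu> \<nu>) = sets \<mu>"
  by (simp add: add_measure_def)

lemma emeasure_add_measure:
  assumes "sets \<nu> = sets \<mu>" "B \<in> sets \<mu>"
  shows "emeasure (add_measure \<mu> \<nu>) B = emeasure \<mu> B + emeasure \<nu> B"
  unfolding add_measure_def
proof (rule emeasure_measure_of_sigma)
  show "countably_additive (sets \<mu>) (\<lambda>B. emeasure \<mu> B + emeasure \<nu> B)"
  proof (rule countably_additiveI)
    fix A :: "nat \<Rightarrow> _"
    assume A: "range A \<subseteq> sets \<mu>" "disjoint_family A"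
    then have "(\<Sum>i. emeasure \<mu> (A i)) = emeasure \<mu> (\<Union>i. A i)"
      and "(\<Sum>i. emeasure \<nu> (A i)) = emeasure \<nu> (\<Union>i. A i)"
      using assms by (auto intro!: suminf_emeasure)
    then show "(\<Sum>i. emeasure \<mu> (A i) + emeasure \<nu> (A i)) =
        emeasure \<mu> (\<Union>i. A i) + emeasure \<nu> (\<Union>i. A i)"
      by (simp add: suminf_add[symmetric])
  qed
qed (use assms in \<open>auto simp: positive_def sets.sigma_algebra_axioms\<close>)

lemma add_dirac_in_point_measures:
  assumes "\<mu> \<in> point_measures"
  shows "add_measure \<mu> (dirac y) \<in> point_measures"
proof -
  have [simp]: "sets \<mu> = sets borel"
    using assms by (simp add: point_measures_def radon_measures_def)
  have "emeasure \<mu> B + indicator B y \<in> \<nat> \<union> {\<infinity>}" if "B \<in> sets borel" for B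
  proof -
    have "emeasure \<mu> B \<in> \<nat> \<union> {\<infinity>}"
      using assms that by (simp add: point_measures_def)
    then show ?thesis
      by (auto simp: indicator_def)
  qed
  moreover have "emeasure \<mu> B + indicator B y < \<infinity>" if "B \<in> sets borel" "bounded B" for B
    using assms that
    by (auto simp: point_measures_def radon_measures_def indicator_def ennreal_add_eq_top less_top)
  ultimately show ?thesis
    by (simp add: point_measures_def radon_measures_def emeasure_add_measure)
qed

lemma topspace_vague_topology [simp]: "topspace vague_topology = radon_measures"
proof -
  have "(\<lambda>_. 0) \<in> vague_test_functions"
    by (auto simp: vague_test_functions_def)
  then show ?thesis
    unfolding vague_topology_def topology_generated_by_topspace
    by (auto intro!: exI[of _ UNIV])
qed

lemma space_point_space [simp]: "space point_space = point_measures"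
proof -
  have "{U. openin vague_topology U} \<subseteq> Pow (radon_measures :: 'a::metric_space measure set)"
    using openin_subset by fastforce
  then show ?thesis
    by (auto simp: point_space_def radon_space_def space_restrict_space space_measure_of
        point_measures_def)
qed

end

theory Submission
  imports Defs
begin

text \<open>
  \<open>(\<A>\<^sub>2) \<Longrightarrow> (\<J>)\<close>: the atoms of \<open>\<mu>\<close> are locally finite, so \<open>x\<close> has a ball \<open>U\<close> on which \<open>\<mu>\<close>
  charges at most the point \<open>x\<close>. The restriction of \<open>\<mu>\<close> to the ball of radius \<open>k\<close> is obtained
  from \<open>\<mu>({x}) \<delta>\<^sub>x\<close> by adding finitely many Dirac measures at points outside \<open>U\<close>, which by
  \<open>(\<A>\<^sub>2)\<close> does not change \<open>\<pi>\<close> on \<open>U\<close>. As \<open>k \<rightarrow> \<infinity>\<close> the restrictions converge vaguely to \<open>\<mu>\<close>, and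
  testing against functions supported in \<open>U\<close> that decrease to the indicator of \<open>{x}\<close> gives
  \<open>\<pi>(\<mu>, {x}) = \<pi>(\<mu>({x}) \<delta>\<^sub>x, {x})\<close>. Since \<open>\<mu>({x})\<close> takes countably many values, this is \<open>(\<J>)\<close>.
  Conversely, \<open>(\<J>)\<close> makes \<open>\<pi>(\<mu>, {x})\<close> a function of \<open>\<mu>({x})\<close>, which is unaffected by adding
  \<open>\<delta>\<^sub>y\<close> with \<open>y \<noteq> x\<close>; a discrete separable space is countable, so these singletons suffice.
\<close>

section \<open>Point measures: restrictions and atoms\<close>

lemma radon_measures_finite:
  assumes "\<mu> \<in> radon_measures" "B \<in> sets borel" "bounded B"
  shows "emeasure \<mu> B < top"
  using assms by (simp add: radon_measures_def)

lemma point_measures_radon: "\<mu> \<in> point_measures \<Longrightarrow> \<mu> \<in> radon_measures"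
  by (simp add: point_measures_def)

lemma point_measures_nat:
  assumes "\<mu> \<in> point_measures" "B \<in> sets borel" "emeasure \<mu> B < \<infinity>"
  obtains n where "emeasure \<mu> B = of_nat n"
  using assms by (auto simp: point_measures_def Nats_def)

lemma radon_measures_sets [simp]: "\<mu> \<in> radon_measures \<Longrightarrow> sets \<mu> = sets borel"
  by (simp add: radon_measures_def)

lemma emeasure_density_indicator:
  assumes "sets \<mu> = sets borel" "A \<in> sets borel" "B \<in> sets borel"
  shows "emeasure (density \<mu> (indicator A)) B = emeasure \<mu> (A \<inter> B)"
  using assms by (simp add: emeasure_restricted)

lemma density_indicator_in_point_measures:
  assumes "\<mu> \<in> point_measures" "A \<in> sets borel"
  shows "density \<mu> (indicator A) \<in> point_measures"
proof -
  have [simp]: "sets \<mu> = sets borel"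
    using assms by (simp add: point_measures_radon)
  have "emeasure \<mu> (A \<inter> B) < top" if "B \<in> sets borel" "bounded B" for B
    using assms that by (intro radon_measures_finite) (auto simp: point_measures_radon)
  moreover have "emeasure \<mu> (A \<inter> B) \<in> \<nat> \<union> {\<infinity>}" if "B \<in> sets borel" for B
    using assms that unfolding point_measures_def by blast
  ultimately show ?thesis
    using assms(2) by (simp add: point_measures_def radon_measures_def emeasure_density_indicator
        del: radon_measures_sets)
qed

text \<open>Continuity from above along balls shrinking to \<open>{x}\<close>, all of finite mass.
  The masses are integers, so their convergence forces equality at some positive radius.\<close>

lemma point_measures_ball:
  assumes \<mu>: "\<mu> \<in> point_measures"
  obtains r where "r > 0" "emeasure \<mu> (ball x r) = emeasure \<mu> {x}"
proof -
  have [simp]: "sets \<mu> = sets borel"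
    using \<mu> by (simp add: point_measures_radon)
  have fin: "emeasure \<mu> (ball x r) < \<infinity>" for r
    using \<mu> by (simp add: point_measures_radon radon_measures_finite)
  have "emeasure \<mu> {x} < \<infinity>"
    using \<mu> by (simp add: point_measures_radon radon_measures_finite)
  then obtain n where n: "emeasure \<mu> {x} = of_nat n"
    using \<mu> by (meson borel_singleton point_measures_nat sets.empty_sets)
  define r where "r k = 1 / real (Suc k)" for k
  have r: "r k > 0" for k
    by (simp add: r_def)
  have "(\<lambda>k. emeasure \<mu> (ball x (r k))) \<longlonglongrightarrow> emeasure \<mu> (\<Inter>k. ball x (r k))"
  proof (rule Lim_emeasure_decseq)
    show "decseq (\<lambda>k. ball x (r k))"
      by (intro decseq_SucI subset_ball) (simp add: r_def field_simps)
  qed (use fin in \<open>auto simp: less_top\<close>)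
  moreover have "(\<Inter>k. ball x (r k)) = {x}"
  proof (intro equalityI subsetI)
    fix y assume y: "y \<in> (\<Inter>k. ball x (r k))"
    show "y \<in> {x}"
    proof (rule ccontr)
      assume "y \<notin> {x}"
      then obtain k where "r k < dist x y"
        unfolding r_def using nat_approx_posE[of "dist x y"] by auto
      moreover have "dist x y < r k"
        using INT_D[OF y, of k] by simp
      ultimately show False by simp
    qed
  qed (use r in auto)
  \<comment> \<open>The strict bound \<open>n + 1\<close> passes from the limit to some ball, and
    for an integer mass it means at most \<open>n\<close>.\<close>
  moreover have "emeasure \<mu> {x} < of_nat (Suc n)"
    unfolding n by (simp only: of_nat_less_iff lessI)
  ultimately have "\<forall>\<^sub>F k in sequentially. emeasure \<mu> (ball x (r k)) < of_nat (Suc n)"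
    by (simp add: order_tendstoD)
  then obtain k where k: "emeasure \<mu> (ball x (r k)) < of_nat (Suc n)"
    by (auto simp: eventually_sequentially)
  obtain m where m: "emeasure \<mu> (ball x (r k)) = of_nat m"
    using \<mu> fin by (meson borel_open open_ball point_measures_nat)
  have "emeasure \<mu> {x} \<le> emeasure \<mu> (ball x (r k))"
    using r by (intro emeasure_mono) auto
  with k m n have "m = n"
    by (simp only: of_nat_less_iff of_nat_le_iff)
  with m n r show ?thesis
    by (intro that[of "r k"]) auto
qed

text \<open>If \<open>B\<close> contained no atom, \<open>point_measures_ball\<close> would give
  each of its points a null ball around it; Lindelof's theorem leaves countably many of these, and
  \<open>B\<close> would be null.\<close>

lemma point_measures_atom:
  fixes \<mu> :: "'a::{metric_space, second_countable_topology} measure"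
  assumes \<mu>: "\<mu> \<in> point_measures" and B: "B \<in> sets borel" "emeasure \<mu> B \<noteq> 0"
  obtains y where "y \<in> B" "emeasure \<mu> {y} \<noteq> 0"
proof (rule ccontr)
  assume "\<not> thesis"
  with that have "emeasure \<mu> {y} = 0" if "y \<in> B" for y
    using \<open>y \<in> B\<close> by auto
  then have "\<exists>r>0. emeasure \<mu> (ball y r) = 0" if "y \<in> B" for y
    using that point_measures_ball[OF \<mu>] by metis
  then obtain r where r: "\<And>y. y \<in> B \<Longrightarrow> r y > 0 \<and> emeasure \<mu> (ball y (r y)) = 0"
    by metis
  obtain \<F> where \<F>: "\<F> \<subseteq> (\<lambda>y. ball y (r y)) ` B" "countable \<F>" "\<Union>\<F> = (\<Union>y\<in>B. ball y (r y))"
    using Lindelof[of "(\<lambda>y. ball y (r y)) ` B"] by auto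
  have sets: "sets \<mu> = sets borel"
    using \<mu> by (simp add: point_measures_radon)
  have "(\<Union>S\<in>\<F>. S) \<in> null_sets \<mu>"
    using \<F>(1,2) r by (intro null_sets_UN') (auto simp: null_sets_def sets)
  moreover have "B \<subseteq> (\<Union>S\<in>\<F>. S)"
    using \<F>(3) r by force
  ultimately show False
    using B by (metis null_sets_subset null_setsD1 sets)
qed

section \<open>Adding and deleting atoms under (A2)\<close>

text \<open>An atom of mass \<open>k\<close> is encoded as \<open>k\<close> successive Dirac
  additions, because (A2) speaks of one at a time.\<close>

lemma funpow_add_dirac:
  assumes "sets \<mu> = sets borel"
  shows "sets (((\<lambda>\<nu>. add_measure \<nu> (dirac y)) ^^ k) \<mu>) = sets borel"
    and "B \<in> sets borel \<Longrightarrow> emeasure (((\<lambda>\<nu>. add_measure \<nu> (dirac y)) ^^ k) \<mu>) B =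
      emeasure \<mu> B + of_nat k * indicator B y"
proof (induction k)
  case (Suc k)
  { case 1 then show ?case using Suc by simp }
  { case 2 then show ?case using Suc
      by (simp add: emeasure_add_measure distrib_right add_ac) }
qed (use assms in auto)

text \<open>Both claims share one induction, since (A2) applies only at point measures.\<close>

lemma A2_funpow_add_dirac:
  assumes "condition_A2 \<pi>" "\<mu> \<in> point_measures" "B \<in> sets borel" "y \<notin> B"
  defines "\<nu> \<equiv> \<lambda>k. ((\<lambda>\<nu>. add_measure \<nu> (dirac y)) ^^ k) \<mu>"
  shows "\<nu> k \<in> point_measures" "emeasure (\<pi> (\<nu> k)) B = emeasure (\<pi> \<mu>) B"
proof (induction k)
  case (Suc k)
  { case 1 then show ?case using Suc by (simp add: \<nu>_def add_dirac_in_point_measures) }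
  { case 2 
    have "emeasure (\<pi> (add_measure (\<nu> k) (dirac y))) B = emeasure (\<pi> (\<nu> k)) B"
      using assms(1,3,4) Suc(1) unfolding condition_A2_def by blast
    then show ?case using Suc by (simp add: \<nu>_def) }
qed (use assms in auto)

text \<open>Strong induction on the mass \<open>n\<close> outside \<open>U\<close>. An atom
  \<open>y\<close> outside \<open>U\<close> is deleted with its whole mass \<open>k\<close>;
  restoring it takes \<open>k\<close> Dirac additions, which (A2) makes invisible on
  \<open>B\<close>.\<close>

lemma A2_restrict:
  fixes \<mu> :: "'a::{metric_space, second_countable_topology} measure"
  assumes A2: "condition_A2 \<pi>" and U: "U \<in> sets borel" and B: "B \<in> sets borel" "B \<subseteq> U"
    and \<mu>: "\<mu> \<in> point_measures" and fin: "emeasure \<mu> (- U) < \<infinity>"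
  shows "emeasure (\<pi> \<mu>) B = emeasure (\<pi> (density \<mu> (indicator U))) B"
proof -
  obtain n where "emeasure \<mu> (- U) = of_nat n"
    using point_measures_nat[OF \<mu> _ fin] U by auto
  then show ?thesis
    using \<mu>
  proof (induction n arbitrary: \<mu> rule: less_induct)
    case (less n \<mu>)
    have [simp]: "sets \<mu> = sets borel"
      using less by (simp add: point_measures_radon)
    show ?case
    proof (cases "n = 0")
      case True
      have "density \<mu> (indicator U) = \<mu>"
      proof (rule measure_eqI)
        fix C assume "C \<in> sets (density \<mu> (indicator U))"
        then have C: "C \<in> sets borel"
          by simp
        have "emeasure \<mu> (C - U) \<le> emeasure \<mu> (- U)"
          using U by (intro emeasure_mono) auto
        then have "emeasure \<mu> (C - U) = 0"
          using less(2) True by simp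
        moreover have "emeasure \<mu> C = emeasure \<mu> (C \<inter> U) + emeasure \<mu> (C - U)"
          using C U by (subst plus_emeasure) (auto intro: arg_cong[of _ _ "emeasure \<mu>"])
        ultimately show "emeasure (density \<mu> (indicator U)) C = emeasure \<mu> C"
          using C U by (simp add: emeasure_density_indicator Int_commute)
      qed simp
      then show ?thesis by simp
    next
      case False
      then obtain y where y: "y \<notin> U" "emeasure \<mu> {y} \<noteq> 0"
        using point_measures_atom[OF less(3), of "- U"] U less(2) by auto
      obtain k where k: "emeasure \<mu> {y} = of_nat k"
        using less(3) radon_measures_finite[OF point_measures_radon[OF less(3)], of "{y}"]
        by (auto elim: point_measures_nat[of _ "{y}"])
      define \<nu> where "\<nu> = density \<mu> (indicator (- {y}))"
      have \<nu>: "\<nu> \<in> point_measures"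
        unfolding \<nu>_def using less(3) by (simp add: density_indicator_in_point_measures)
      have \<nu>E: "emeasure \<nu> C = emeasure \<mu> (- {y} \<inter> C)" if "C \<in> sets borel" for C
        using that by (simp add: \<nu>_def emeasure_density_indicator)
      have split: "emeasure \<mu> C = emeasure \<nu> C + of_nat k * indicator C y" 
        if C: "C \<in> sets borel" for C
      proof -
        have "emeasure \<mu> C = emeasure \<mu> (- {y} \<inter> C) + emeasure \<mu> ({y} \<inter> C)"
          using C by (subst plus_emeasure) (auto intro: arg_cong[of _ _ "emeasure \<mu>"])
        then show ?thesis
          using C k by (auto simp: \<nu>E indicator_def)
      qed
      have \<mu>_eq: "\<mu> = ((\<lambda>\<nu>. add_measure \<nu> (dirac y)) ^^ k) \<nu>"
        using \<nu> by (intro measure_eqI) (simp_all add: funpow_add_dirac point_measures_radon split)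
      have n: "of_nat n = emeasure \<nu> (- U) + of_nat k"
        using split[of "- U"] U y less(2) by simp
      then have "emeasure \<nu> (- U) < \<infinity>"
        by (metis ennreal_add_eq_top ennreal_of_nat_neq_top infinity_ennreal_def less_top)
      then obtain m where m: "emeasure \<nu> (- U) = of_nat m"
        using point_measures_nat[OF \<nu>] U by (metis borel_comp)
      have "n = m + k"
        using n unfolding m by (simp only: of_nat_add[symmetric] of_nat_eq_iff)
      \<comment> \<open>\<open>k\<close> is nonzero because \<open>y\<close> is an atom, so the
        induction hypothesis covers \<open>\<nu>\<close>.\<close>
      then have "m < n"
        using k y by (cases k) auto
      have "emeasure (\<pi> \<mu>) B = emeasure (\<pi> \<nu>) B"
        using A2_funpow_add_dirac(2)[OF A2 \<nu> B(1), of y k] B(2) y \<mu>_eq by auto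
      also have "\<dots> = emeasure (\<pi> (density \<nu> (indicator U))) B"
        using less(1)[OF \<open>m < n\<close> m \<nu>] .
      also have "density \<nu> (indicator U) = density \<mu> (indicator U)"
      proof (rule measure_eqI)
        fix C assume "C \<in> sets (density \<nu> (indicator U))"
        then have "C \<in> sets borel"
          by (simp add: \<nu>_def)
        moreover have "- {y} \<inter> (U \<inter> C) = U \<inter> C"
          using y by auto
        ultimately show "emeasure (density \<nu> (indicator U)) C = emeasure (density \<mu> (indicator U)) C"
          using U \<nu> by (simp add: emeasure_density_indicator \<nu>E point_measures_radon)
      qed (simp add: \<nu>_def)
      finally show ?thesis .
    qed
  qed
qed

section \<open>Vague convergence\<close>

text \<open>Serves twice: to compare \<open>\<mu>\<close> with its truncations to large balls, and
  to compare values of \<open>\<pi>\<close> known to agree only inside a small ball.\<close>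

lemma integral_density_indicator:
  fixes f :: "'a::topological_space \<Rightarrow> real"
  assumes "sets M = sets borel" "f \<in> borel_measurable borel" "A \<in> sets borel"
    and "\<And>y. y \<notin> A \<Longrightarrow> f y = 0"
  shows "(\<integral>y. f y \<partial>density M (indicator A)) = (\<integral>y. f y \<partial>M)"
proof -
  have [measurable_cong]: "sets M = sets borel" by fact
  note [measurable] = assms(2,3)
  have "(\<integral>y. f y \<partial>density M (\<lambda>y. ennreal (indicator A y))) = (\<integral>y. indicator A y *\<^sub>R f y \<partial>M)"
    by (intro integral_density) auto
  also have "(\<lambda>y. indicator A y *\<^sub>R f y) = f"
    using assms(4) by (intro ext) (metis indicator_simps scaleR_one scaleR_zero_left)
  finally show ?thesis
    by (simp add: ennreal_indicator)
qed

lemma openin_vague_topology_integral: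
  assumes "f \<in> vague_test_functions" "open V"
  shows "openin vague_topology {\<mu> \<in> radon_measures. (\<integral>y. f y \<partial>\<mu>) \<in> V}"
  unfolding vague_topology_def using assms by (intro topology_generated_by_Basis) blast

text \<open>Induction over the generation of open sets from the subbase: eventual membership
  survives finite intersections and unions, and on a subbasic set it is the assumed convergence of
  integrals.\<close>

lemma limitin_vague_topology:
  assumes \<mu>: "\<mu> \<in> radon_measures" and \<nu>: "\<forall>\<^sub>F k in F. \<nu> k \<in> radon_measures"
    and lim: "\<And>f. f \<in> vague_test_functions \<Longrightarrow> ((\<lambda>k. \<integral>y. f y \<partial>\<nu> k) \<longlongrightarrow> (\<integral>y. f y \<partial>\<mu>)) F"
  shows "limitin vague_topology \<nu> \<mu> F"
proof -
  have "\<forall>\<^sub>F k in F. \<nu> k \<in> W" if "openin vague_topology W" "\<mu> \<in> W" for W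
    using openin_topology_generated_by[OF that(1)[unfolded vague_topology_def]] that(2)
  proof induction
    case (Int a b)
    then show ?case
      by (auto intro: eventually_conj)
  next
    case (UN K)
    then obtain S where S: "S \<in> K" "\<mu> \<in> S" 
      by auto
    with UN have "\<forall>\<^sub>F k in F. \<nu> k \<in> S"
      by blast
    with S(1) show ?case
      by (auto elim!: eventually_mono)
  next
    case (Basis s)
    then obtain f V where s: "s = {\<mu> \<in> radon_measures. (\<integral>y. f y \<partial>\<mu>) \<in> V}"
      and fV: "f \<in> vague_test_functions" "open V"
      by auto
    have "\<forall>\<^sub>F k in F. (\<integral>y. f y \<partial>\<nu> k) \<in> V"
      using topological_tendstoD[OF lim[OF fV(1)] fV(2)] Basis(2) s by auto
    with \<nu> show ?case
      unfolding s by eventually_elim auto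
  qed auto
  with \<mu> show ?thesis
    by (simp add: limitin_def)
qed

text \<open>A test function has bounded support, so its integral is unaffected by the truncation
  once \<open>k\<close> is large.\<close>

lemma limitin_restrict_balls:
  assumes \<mu>: "\<mu> \<in> point_measures"
  shows "limitin vague_topology (\<lambda>k. density \<mu> (indicator (ball x (real k)))) \<mu> sequentially"
proof (rule limitin_vague_topology)
  fix f :: "'a \<Rightarrow> real" assume f: "f \<in> vague_test_functions"
  then have "bounded {y. f y \<noteq> 0}"
    unfolding vague_test_functions_def using bounded_subset[OF _ closure_subset] by blast
  then obtain R where R: "{y. f y \<noteq> 0} \<subseteq> ball x R"
    by (metis bounded_subset_ballD)
  have fm: "f \<in> borel_measurable borel"
    using f by (auto simp: vague_test_functions_def intro: borel_measurable_continuous_onI)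
  have "\<forall>\<^sub>F k in sequentially. R \<le> real k"
    by (metis (no_types, lifting) eventually_sequentiallyI linorder_le_cases nat_ceiling_le_eq
        order_trans)
  then have "\<forall>\<^sub>F k in sequentially.
      (\<integral>y. f y \<partial>\<mu>) = (\<integral>y. f y \<partial>density \<mu> (indicator (ball x (real k))))"
  proof eventually_elim
    case (elim k)
    then show ?case
      using \<mu> R fm by (intro integral_density_indicator[symmetric])
        (auto simp: point_measures_radon subset_iff)
  qed
  then show "((\<lambda>k. \<integral>y. f y \<partial>density \<mu> (indicator (ball x (real k)))) \<longlongrightarrow> (\<integral>y. f y \<partial>\<mu>))
      sequentially"
    by (rule Lim_transform_eventually[OF tendsto_const])
qed (use \<mu> in \<open>auto intro!: always_eventually point_measures_radon
    density_indicator_in_point_measures\<close>)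

text \<open>Continuous maps preserve limits, and requiring the integral of \<open>f\<close> to lie
  in an open set defines a vaguely open set.\<close>

lemma vaguely_continuous_tendsto:
  assumes "vaguely_continuous \<pi>" "\<mu> \<in> point_measures" "\<And>k. \<nu> k \<in> point_measures"
    and "limitin vague_topology \<nu> \<mu> sequentially" and f: "f \<in> vague_test_functions"
  shows "(\<lambda>k. \<integral>y. f y \<partial>\<pi> (\<nu> k)) \<longlonglongrightarrow> (\<integral>y. f y \<partial>\<pi> \<mu>)"
proof -
  have "limitin (subtopology vague_topology point_measures) \<nu> \<mu> sequentially"
    using assms by (simp add: limitin_subtopology)
  then have "limitin vague_topology (\<pi> \<circ> \<nu>) (\<pi> \<mu>) sequentially"
    using assms(1) unfolding vaguely_continuous_def by (metis continuous_map_limit)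
  then have lim: "\<forall>\<^sub>F k in sequentially. \<pi> (\<nu> k) \<in> W"
    if "openin vague_topology W" "\<pi> \<mu> \<in> W" for W
    using that by (simp add: limitin_def)
  have "\<pi> \<mu> \<in> radon_measures"
    using \<open>limitin vague_topology (\<pi> \<circ> \<nu>) (\<pi> \<mu>) sequentially\<close> by (simp add: limitin_def)
  show ?thesis
  proof (rule topological_tendstoI)
    fix V :: "real set" assume "open V" "(\<integral>y. f y \<partial>\<pi> \<mu>) \<in> V"
    then show "\<forall>\<^sub>F k in sequentially. (\<integral>y. f y \<partial>\<pi> (\<nu> k)) \<in> V"
      using lim[OF openin_vague_topology_integral[OF f \<open>open V\<close>]] \<open>\<pi> \<mu> \<in> radon_measures\<close>
      by (simp add: eventually_conj_iff)
  qed
qed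

section \<open>Cutoff functions shrinking to a point\<close>

text \<open>For \<open>r > 0\<close>, a cone with peak 1 at \<open>x\<close> that vanishes from
  distance \<open>r / (j + 1)\<close> on. The factor \<open>Suc j\<close> keeps even the case
  \<open>j = 0\<close> supported in the ball of radius \<open>r\<close>.\<close>

definition tent :: "'a::metric_space \<Rightarrow> real \<Rightarrow> nat \<Rightarrow> 'a \<Rightarrow> real" where
  "tent x r j y = max 0 (1 - real (Suc j) * dist x y / r)"

lemma tent_outside_ball:
  assumes "r > 0" "y \<notin> ball x r"
  shows "tent x r j y = 0"
proof -
  have "r \<le> dist x y"
    using assms(2) by simp
  also have "\<dots> \<le> real (Suc j) * dist x y"
    by (simp add: algebra_simps)
  finally show ?thesis
    using assms(1) by (simp add: tent_def field_simps)
qed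

lemma tent_bounds: 
  assumes "r > 0"
  shows "0 \<le> tent x r j y" "tent x r j y \<le> 1"
  using assms by (auto simp: tent_def)

lemma tent_test_function:
  assumes "r > 0"
  shows "tent x r j \<in> vague_test_functions"
proof -
  have "continuous_on UNIV (tent x r j)"
    unfolding tent_def using assms by (intro continuous_intros) auto
  moreover have "range (tent x r j) \<subseteq> {0..1}"
    using tent_bounds[OF assms] by auto
  then have "bounded (range (tent x r j))"
    by (rule bounded_subset[OF bounded_closed_interval])
  moreover have "{y. tent x r j y \<noteq> 0} \<subseteq> ball x r"
    using tent_outside_ball[OF assms] by blast
  then have "bounded (closure {y. tent x r j y \<noteq> 0})"
    by (intro bounded_closure) (rule bounded_subset[OF bounded_ball])
  ultimately show ?thesis
    by (simp add: vague_test_functions_def)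
qed

lemma tent_measurable: "r > 0 \<Longrightarrow> tent x r j \<in> borel_measurable borel"
  using tent_test_function[of r x j]
  by (intro borel_measurable_continuous_onI) (simp add: vague_test_functions_def)

lemma tent_tendsto:
  assumes "r > 0"
  shows "(\<lambda>j. tent x r j y) \<longlonglongrightarrow> indicator {x} y"
proof (cases "y = x")
  case True
  then show ?thesis by (simp add: tent_def)
next
  case False
  \<comment> \<open>From this index on the cone is too narrow to reach \<open>y\<close>.\<close>
  then obtain N where N: "r / dist x y < real N"
    using reals_Archimedean2 by blast
  have "tent x r j y = 0" if "j \<ge> N" for j
  proof -
    have "r / dist x y \<le> real (Suc j)"
      using N that by linarith
    then show ?thesis
      using assms False by (simp add: tent_def field_simps)
  qed
  then show ?thesis
    using False by (intro tendsto_eventually) (auto simp: eventually_sequentially)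
qed

text \<open>Dominated convergence: the ball is bounded, so its indicator is an integrable majorant
  of all the cutoffs.\<close>

lemma tent_integral_tendsto:
  assumes M: "M \<in> radon_measures" and r: "r > 0"
  shows "(\<lambda>j. \<integral>y. tent x r j y \<partial>M) \<longlonglongrightarrow> measure M {x}"
proof -
  have [measurable_cong]: "sets M = sets borel"
    using M by simp
  have "(\<lambda>j. \<integral>y. tent x r j y \<partial>M) \<longlonglongrightarrow> (\<integral>y. indicator {x} y \<partial>M)"
  proof (rule integral_dominated_convergence[where w = "indicator (ball x r)"])
    show "integrable M (indicator (ball x r) :: 'a \<Rightarrow> real)"
      using radon_measures_finite[OF M, of "ball x r"] M by (simp add: integrable_indicator_iff)
    show "tent x r j \<in> borel_measurable M" for j
      using tent_measurable[OF r] by measurable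
    show "AE y in M. norm (tent x r j y) \<le> indicator (ball x r) y" for j
      using tent_bounds[OF r, of x j] tent_outside_ball[OF r, of _ x j]
      by (intro AE_I2) (simp add: indicator_def)
  qed (use r in \<open>auto intro: tent_tendsto\<close>)
  then show ?thesis
    using M by simp
qed

section \<open>From (A2) to (J)\<close>

text \<open>\<open>A2_restrict\<close> needs finite mass outside \<open>ball x r\<close>, which
  \<open>\<mu>\<close> may lack; it is applied to the truncations \<open>\<nu> k\<close>, and vague
  continuity carries the result to \<open>\<mu>\<close>. Only integrals of test functions pass to
  this limit, hence the cutoffs.\<close>

lemma A2_emeasure_singleton:
  fixes \<pi> :: "'a::{metric_space, second_countable_topology} measure \<Rightarrow> 'a measure"
  assumes \<pi>: "radon_kernel \<pi>" "vaguely_continuous \<pi>" "condition_A2 \<pi>"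
    and \<mu>: "\<mu> \<in> point_measures"
  shows "emeasure (\<pi> \<mu>) {x} = emeasure (\<pi> (density \<mu> (indicator {x}))) {x}"
proof -
  define \<rho> where "\<rho> = density \<mu> (indicator {x})"
  have [simp]: "sets \<mu> = sets borel"
    using \<mu> by (simp add: point_measures_radon)
  have radon: "\<pi> \<nu> \<in> radon_measures" if "\<nu> \<in> point_measures" for \<nu>
    using \<pi>(1) that by (simp add: radon_kernel_def)
  have \<rho>: "\<rho> \<in> point_measures"
    unfolding \<rho>_def using \<mu> by (simp add: density_indicator_in_point_measures)
  obtain r where r: "r > 0" "emeasure \<mu> (ball x r) = emeasure \<mu> {x}"
    using point_measures_ball[OF \<mu>] .
  define \<nu> where "\<nu> k = density \<mu> (indicator (ball x (real k)))" for k
  have \<nu>: "\<nu> k \<in> point_measures" for k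
    unfolding \<nu>_def using \<mu> by (simp add: density_indicator_in_point_measures)
  \<comment> \<open>For \<open>k = 0\<close> the truncating ball is empty and loses
    \<open>x\<close>. For \<open>k > 0\<close> it contains \<open>x\<close>, and
    \<open>ball x r\<close> carries no mass off \<open>x\<close>, so just the atom remains.\<close>
  have \<nu>_ball: "density (\<nu> k) (indicator (ball x r)) = \<rho>" if "k > 0" for k
  proof (rule measure_eqI)
    fix C assume "C \<in> sets (density (\<nu> k) (indicator (ball x r)))"
    then have C: "C \<in> sets borel"
      by (simp add: \<nu>_def)
    have "emeasure \<mu> (ball x r) = emeasure \<mu> {x} + emeasure \<mu> (ball x r - {x})"
      using r(1) by (subst plus_emeasure) (auto intro: arg_cong[of _ _ "emeasure \<mu>"])
    moreover have "emeasure \<mu> {x} < \<infinity>"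
      using \<mu> by (simp add: point_measures_radon radon_measures_finite)
    \<comment> \<open>Cancelling \<open>emeasure \<mu> {x}\<close> is legitimate because it is
      finite.\<close>
    ultimately have null: "emeasure \<mu> (ball x r - {x}) = 0"
      using r(2) by (metis add.right_neutral ennreal_add_left_cancel infinity_ennreal_def less_irrefl)
    let ?A = "ball x (real k) \<inter> (ball x r \<inter> C)"
    have "?A - {x} \<subseteq> ball x r - {x}"
      by auto
    then have "emeasure \<mu> (?A - {x}) \<le> emeasure \<mu> (ball x r - {x})"
      by (intro emeasure_mono) auto
    with null have null': "emeasure \<mu> (?A - {x}) = 0"
      by simp
    have "?A = ({x} \<inter> C) \<union> (?A - {x})"
      using r(1) \<open>k > 0\<close> by auto
    then have "emeasure \<mu> ?A = emeasure \<mu> (({x} \<inter> C) \<union> (?A - {x}))"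
      by simp
    also have "\<dots> = emeasure \<mu> ({x} \<inter> C) + emeasure \<mu> (?A - {x})"
      using C by (subst plus_emeasure) auto
    finally have "emeasure \<mu> ?A = emeasure \<mu> ({x} \<inter> C)"
      using null' by simp
    then show "emeasure (density (\<nu> k) (indicator (ball x r))) C = emeasure \<rho> C"
      using C by (simp add: \<nu>_def \<rho>_def emeasure_density_indicator)
  qed (simp add: \<nu>_def \<rho>_def)
  have same: "emeasure (\<pi> (\<nu> k)) B = emeasure (\<pi> \<rho>) B"
    if "k > 0" "B \<in> sets borel" "B \<subseteq> ball x r" for k B
  proof -
    \<comment> \<open>\<open>\<nu> k\<close> lives on a bounded ball, which supplies the finiteness
      for \<open>A2_restrict\<close>.\<close>
    have "emeasure (\<nu> k) (- ball x r) = emeasure \<mu> (ball x (real k) \<inter> - ball x r)"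
      by (simp add: \<nu>_def emeasure_density_indicator)
    also have "\<dots> < top"
      using \<mu> by (intro radon_measures_finite) (auto simp: point_measures_radon)
    finally show ?thesis
      using A2_restrict[OF \<pi>(3) _ that(2,3) \<nu>, of k] \<nu>_ball[OF that(1)] by simp
  qed
  \<comment> \<open>For fixed \<open>j\<close>, two limits of one sequence in \<open>k\<close>:
    vague continuity yields the left side, while the sequence equals the right side from
    \<open>k = 1\<close> on.\<close>
  have tent: "(\<integral>y. tent x r j y \<partial>\<pi> \<mu>) = (\<integral>y. tent x r j y \<partial>\<pi> \<rho>)" for j
  proof (rule LIMSEQ_unique)
    show "(\<lambda>k. \<integral>y. tent x r j y \<partial>\<pi> (\<nu> k)) \<longlonglongrightarrow> (\<integral>y. tent x r j y \<partial>\<pi> \<mu>)"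
      using \<pi>(2) \<mu> \<nu> limitin_restrict_balls[OF \<mu>] tent_test_function[OF r(1)]
      unfolding \<nu>_def by (intro vaguely_continuous_tendsto) auto
    have "(\<integral>y. tent x r j y \<partial>\<pi> (\<nu> k)) = (\<integral>y. tent x r j y \<partial>\<pi> \<rho>)" if "k > 0" for k
    proof -
      have restrict: "(\<integral>y. tent x r j y \<partial>\<pi> \<kappa>) =
          (\<integral>y. tent x r j y \<partial>density (\<pi> \<kappa>) (indicator (ball x r)))"
        if "\<kappa> \<in> point_measures" for \<kappa>
        using radon[OF that] tent_measurable[OF r(1)] tent_outside_ball[OF r(1)]
        by (intro integral_density_indicator[symmetric]) simp_all
      have "density (\<pi> (\<nu> k)) (indicator (ball x r)) = density (\<pi> \<rho>) (indicator (ball x r))"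
        using same[OF that] radon \<nu> \<rho>
        by (intro measure_eqI) (auto simp: emeasure_density_indicator)
      then show ?thesis
        using restrict \<nu> \<rho> by simp
    qed
    then show "(\<lambda>k. \<integral>y. tent x r j y \<partial>\<pi> (\<nu> k)) \<longlonglongrightarrow> (\<integral>y. tent x r j y \<partial>\<pi> \<rho>)"
      by (intro tendsto_eventually) (auto simp: eventually_sequentially intro!: exI[of _ 1])
  qed
  \<comment> \<open>Only now \<open>j\<close> tends to infinity.\<close>
  have "measure (\<pi> \<mu>) {x} = measure (\<pi> \<rho>) {x}"
    using tent_integral_tendsto[OF radon[OF \<mu>] r(1), of x]
      tent_integral_tendsto[OF radon[OF \<rho>] r(1), of x]
    unfolding tent by (rule LIMSEQ_unique)
  moreover have "emeasure (\<pi> \<kappa>) {x} = ennreal (measure (\<pi> \<kappa>) {x})" if "\<kappa> \<in> point_measures" for \<kappa>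
    using radon_measures_finite[OF radon[OF that], of "{x}"]
    by (intro emeasure_eq_ennreal_measure) (auto simp: less_top)
  ultimately show ?thesis
    using \<mu> \<rho> by (simp add: \<rho>_def)
qed

text \<open>By \<open>A2_emeasure_singleton\<close>, \<open>\<pi>(\<mu>, {x})\<close> depends on
  \<open>\<mu>({x})\<close> alone. The latter takes countably many values, so any set of its values
  is Borel and any such dependence is measurable.\<close>

lemma A2_imp_J:
  fixes \<pi> :: "'a::{metric_space, second_countable_topology} measure \<Rightarrow> 'a measure"
  assumes \<pi>: "radon_kernel \<pi>" "vaguely_continuous \<pi>" "condition_A2 \<pi>"
  shows "condition_J \<pi>"
  unfolding condition_J_def
proof
  fix x :: 'a
  let ?\<zeta> = "\<lambda>\<mu>::'a measure. emeasure \<mu> {x}" and ?g = "\<lambda>\<mu>. emeasure (\<pi> \<mu>) {x}"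
  have eq: "?g \<mu> = ?g \<nu>" if "\<mu> \<in> point_measures" "\<nu> \<in> point_measures" "?\<zeta> \<mu> = ?\<zeta> \<nu>" for \<mu> \<nu>
  proof -
    have [simp]: "sets \<mu> = sets borel" "sets \<nu> = sets borel"
      using that by (simp_all add: point_measures_radon)
    have "density \<mu> (indicator {x}) = density \<nu> (indicator {x})"
    proof (rule measure_eqI)
      fix C assume "C \<in> sets (density \<mu> (indicator {x}))"
      then show "emeasure (density \<mu> (indicator {x})) C = emeasure (density \<nu> (indicator {x})) C"
        using that(3) by (cases "x \<in> C") (simp_all add: emeasure_density_indicator)
    qed simp
    then show ?thesis
      using A2_emeasure_singleton[OF \<pi> that(1), of x] A2_emeasure_singleton[OF \<pi> that(2), of x]
      by simp
  qed
  show "?g \<in> borel_measurable (vimage_algebra point_measures ?\<zeta> borel)"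
  proof (rule measurableI)
    fix A :: "ennreal set" assume "A \<in> sets borel"
    \<comment> \<open>By \<open>eq\<close> the preimage of \<open>A\<close> is a union of fibres of
      \<open>?\<zeta>\<close>, so it is recovered from its image \<open>S\<close>.\<close>
    define S where "S = ?\<zeta> ` (?g -` A \<inter> point_measures)"
    have "S \<subseteq> range of_nat \<union> {\<infinity>}"
      unfolding S_def by (auto simp: point_measures_def Nats_def)
    then have "countable S"
      by (rule countable_subset) auto
    then have "S \<in> sets borel"
      by (rule sets.countable[rotated]) simp
    moreover have "?g -` A \<inter> point_measures = ?\<zeta> -` S \<inter> point_measures"
    proof (intro equalityI subsetI)
      fix \<mu> assume \<mu>: "\<mu> \<in> ?\<zeta> -` S \<inter> point_measures"
      then obtain \<nu> where "\<nu> \<in> point_measures" "?g \<nu> \<in> A" "?\<zeta> \<mu> = ?\<zeta> \<nu>"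
        by (auto simp: S_def)
      with \<mu> show "\<mu> \<in> ?g -` A \<inter> point_measures"
        using eq[of \<mu> \<nu>] by simp
    qed (auto simp: S_def)
    ultimately show "?g -` A \<inter> space (vimage_algebra point_measures ?\<zeta> borel) \<in>
        sets (vimage_algebra point_measures ?\<zeta> borel)"
      using in_vimage_algebra[of S borel ?\<zeta> point_measures] by simp
  qed simp
qed

section \<open>From (J) to (A2) on discrete spaces\<close>

text \<open>The level set of \<open>\<pi>(\<cdot>, {x})\<close> through \<open>\<mu>\<close> is
  measurable, hence a preimage under the evaluation at \<open>{x}\<close>; with \<open>\<mu>\<close>
  it contains every point measure of the same mass at \<open>x\<close>.\<close>

lemma J_emeasure_singleton:
  assumes "condition_J \<pi>" "\<mu> \<in> point_measures" "\<nu> \<in> point_measures"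
    and "emeasure \<mu> {x} = emeasure \<nu> {x}"
  shows "emeasure (\<pi> \<mu>) {x} = emeasure (\<pi> \<nu>) {x}"
proof -
  let ?V = "vimage_algebra point_measures (\<lambda>\<mu>. emeasure \<mu> {x}) borel"
  have "(\<lambda>\<mu>. emeasure (\<pi> \<mu>) {x}) \<in> borel_measurable ?V"
    by (rule assms(1)[unfolded condition_J_def, rule_format])
  then have "(\<lambda>\<mu>. emeasure (\<pi> \<mu>) {x}) -` {emeasure (\<pi> \<mu>) {x}} \<inter> space ?V \<in> sets ?V"
    by (rule measurable_sets) simp
  then obtain A where "(\<lambda>\<mu>. emeasure (\<pi> \<mu>) {x}) -` {emeasure (\<pi> \<mu>) {x}} \<inter> point_measures =
      (\<lambda>\<mu>. emeasure \<mu> {x}) -` A \<inter> point_measures"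
    by (auto simp: sets_vimage_algebra2)
  then have "\<kappa> \<in> point_measures \<Longrightarrow>
      emeasure (\<pi> \<kappa>) {x} = emeasure (\<pi> \<mu>) {x} \<longleftrightarrow> emeasure \<kappa> {x} \<in> A" for \<kappa>
    by (auto simp: set_eq_iff)
  with assms(2-4) show ?thesis
    by metis
qed

text \<open>Singletons are open, so Lindelof's theorem applies to the cover by all of them.\<close>

lemma discrete_imp_countable:
  assumes "discrete (UNIV :: 'a::second_countable_topology set)"
  shows "countable (UNIV :: 'a set)"
proof -
  have "\<And>S. S \<in> range (\<lambda>x::'a. {x}) \<Longrightarrow> open S"
    using discreteD[OF assms] by (force simp: isolated_in_def)
  then obtain \<F> where \<F>: "\<F> \<subseteq> range (\<lambda>x::'a. {x})" "countable \<F>" "\<Union>\<F> = \<Union>(range (\<lambda>x::'a. {x}))"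
    by (rule Lindelof)
  have "countable (\<Union>\<F>)"
    using countable_UN[OF \<F>(2), of "\<lambda>S. S"] \<F>(1) by fastforce
  with \<F>(3) show ?thesis by simp
qed

text \<open>Since \<open>B\<close> is countable, its mass is the sum of the masses of its points.
  Adding a Dirac mass at \<open>y\<close> outside \<open>B\<close> leaves \<open>\<mu>({x})\<close>
  unchanged for each \<open>x\<close> in \<open>B\<close>, so (J) fixes every summand.\<close>

lemma J_imp_A2:
  fixes \<pi> :: "'a::{metric_space, second_countable_topology} measure \<Rightarrow> 'a measure"
  assumes \<pi>: "radon_kernel \<pi>" "condition_J \<pi>" and disc: "discrete (UNIV :: 'a set)"
  shows "condition_A2 \<pi>"
  unfolding condition_A2_def
proof (intro allI ballI impI)
  fix y :: 'a and \<mu> :: "'a measure" and B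
  assume \<mu>: "\<mu> \<in> point_measures" and B: "B \<in> sets borel" "B \<subseteq> UNIV - {y}"
  have \<nu>: "add_measure \<mu> (dirac y) \<in> point_measures"
    using \<mu> by (rule add_dirac_in_point_measures)
  have "countable B"
    using discrete_imp_countable[OF disc] by (rule countable_subset[rotated]) simp
  then have sum: "emeasure (\<pi> \<kappa>) B = (\<integral>\<^sup>+x. emeasure (\<pi> \<kappa>) {x} \<partial>count_space B)"
    if "\<kappa> \<in> point_measures" for \<kappa>
    using \<pi>(1) that by (intro emeasure_countable_singleton) (auto simp: radon_kernel_def)
  have "emeasure (\<pi> (add_measure \<mu> (dirac y))) {x} = emeasure (\<pi> \<mu>) {x}" if "x \<in> B" for x
  proof (rule J_emeasure_singleton[OF \<pi>(2) \<nu> \<mu>])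
    show "emeasure (add_measure \<mu> (dirac y)) {x} = emeasure \<mu> {x}"
      using \<mu> that B(2) by (subst emeasure_add_measure) (auto simp: point_measures_radon indicator_def)
  qed
  then show "emeasure (\<pi> (add_measure \<mu> (dirac y))) B = emeasure (\<pi> \<mu>) B"
    using sum[OF \<nu>] sum[OF \<mu>] by (simp cong: nn_integral_cong_simp)
qed

theorem theorem3p3:
  fixes \<pi> :: "'a::polish_space measure \<Rightarrow> 'a measure"
  assumes "radon_kernel \<pi>"
    and "vaguely_continuous \<pi>"
    and "cocycle_condition \<pi>"
  shows "(condition_A2 \<pi> \<longrightarrow> condition_J \<pi>) \<and>
    (discrete (UNIV :: 'a set) \<longrightarrow> condition_J \<pi> \<longrightarrow> condition_A2 \<pi>)"
  using assms A2_imp_J J_imp_A2 by blast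

end
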